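(* Let $a\in\mathbb R\setminus\{0\}$ and let $G$ be the four-dimensional connected solvable Lie group \[ G=\left\{ \begin{pmatrix} e^{a x_4} & 0 & 0 & x_1\\ 0 & e^{x_4} & x_4e^{x_4} & x_2\\ 0&0&e^{x_4}&x_3\\ 0&0&0&1\end{pmatrix} : x_1,x_2,x_3,x_4\in\mathbb R\right\}. \] Then $G$ is not the multiplication group of a connected topological proper loop.
   Context: A loop $(L,\cdot)$ is a set with a binary operation having an identity element $e$ ($e\cdot x=x\cdot e=x$ for all $x$) such that for all $a,b\in L$ the equations $a\cdot y=b$ and $x\cdot a=b$ have unique solutions $y=a\backslash b$ and $x=b/a$. A loop is proper if it is not a group. A loop is topological if $L$ is a topological space and the operations $(x,y)\mapsto x\cdot y$, $x\backslash y$, $y/x$ from $L\times L$ to $L$ are continuous; it is connected if the space $L$ is connected. The multiplication group $Mult(L)$ of $L$ is the group of permutations of $L$ generated by all left translations $\lambda_a:y\mapsto a\cdot y$ and all right translations $\rho_a:y\mapsto y\cdot a$, $a\in L$. For topological loops, the loops considered with a Lie group as multiplication group are realized on manifolds $G/H$ on which the Lie group acts continuously, transitively and effectively, $H$ being the stabilizer of $e$. *)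

theory Defs
  imports "HOL-Analysis.Analysis" "HOL-Algebra.Bij" "HOL-Algebra.Elementary_Groups"
begin

text \<open>A loop is carried by the \<open>monoid\<close> record of HOL-Algebra: carrier, multiplication, identity.
  No associativity is part of that record type.\<close>

locale loop =
  fixes L (structure)
  assumes mult_closed: "\<lbrakk>x \<in> carrier L; y \<in> carrier L\<rbrakk> \<Longrightarrow> x \<otimes> y \<in> carrier L"
    and one_closed: "\<one> \<in> carrier L"
    and left_one: "x \<in> carrier L \<Longrightarrow> \<one> \<otimes> x = x"
    and right_one: "x \<in> carrier L \<Longrightarrow> x \<otimes> \<one> = x"
    and left_div_unique:
      "\<lbrakk>a \<in> carrier L; b \<in> carrier L\<rbrakk> \<Longrightarrow> \<exists>!y. y \<in> carrier L \<and> a \<otimes> y = b"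
    and right_div_unique:
      "\<lbrakk>a \<in> carrier L; b \<in> carrier L\<rbrakk> \<Longrightarrow> \<exists>!x. x \<in> carrier L \<and> x \<otimes> a = b"

definition loop_ldiv :: "('a, 'b) monoid_scheme \<Rightarrow> 'a \<Rightarrow> 'a \<Rightarrow> 'a" where
  "loop_ldiv L a b = (THE y. y \<in> carrier L \<and> a \<otimes>\<^bsub>L\<^esub> y = b)"

definition loop_rdiv :: "('a, 'b) monoid_scheme \<Rightarrow> 'a \<Rightarrow> 'a \<Rightarrow> 'a" where
  "loop_rdiv L b a = (THE x. x \<in> carrier L \<and> x \<otimes>\<^bsub>L\<^esub> a = b)"

definition proper_loop :: "('a, 'b) monoid_scheme \<Rightarrow> bool" where
  "proper_loop L \<longleftrightarrow> loop L \<and> \<not> group L"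

locale topological_loop = loop L for L (structure) +
  fixes T :: "'a topology"
  assumes topspace_eq: "topspace T = carrier L"
    and continuous_mult:
      "continuous_map (prod_topology T T) T (\<lambda>(x, y). x \<otimes> y)"
    and continuous_ldiv:
      "continuous_map (prod_topology T T) T (\<lambda>(x, y). loop_ldiv L x y)"
    and continuous_rdiv:
      "continuous_map (prod_topology T T) T (\<lambda>(x, y). loop_rdiv L y x)"

definition left_translation :: "('a, 'b) monoid_scheme \<Rightarrow> 'a \<Rightarrow> 'a \<Rightarrow> 'a" where
  "left_translation L a = (\<lambda>y\<in>carrier L. a \<otimes>\<^bsub>L\<^esub> y)"

definition right_translation :: "('a, 'b) monoid_scheme \<Rightarrow> 'a \<Rightarrow> 'a \<Rightarrow> 'a" where
  "right_translation L a = (\<lambda>y\<in>carrier L. y \<otimes>\<^bsub>L\<^esub> a)"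

definition Mult :: "('a, 'b) monoid_scheme \<Rightarrow> ('a \<Rightarrow> 'a) monoid" where
  "Mult L = subgroup_generated (BijGroup (carrier L))
     (left_translation L ` carrier L \<union> right_translation L ` carrier L)"

text \<open>The topological group \<open>(G, S)\<close> is the multiplication group of the topological loop
  \<open>(L, T)\<close>: an isomorphism \<open>\<phi>\<close> of \<open>G\<close> onto \<open>Mult L\<close> makes \<open>G\<close> act on the space \<open>L\<close>
  continuously, and \<open>L\<close> is the homogeneous space \<open>G/H\<close>, where \<open>H\<close> is the stabilizer of the
  identity \<open>e\<close> of \<open>L\<close>. The fibres of the orbit map \<open>g \<mapsto> \<phi> g e\<close> are the cosets \<open>g H\<close>, so the
  orbit map being a quotient map says exactly that it induces a homeomorphism of \<open>G/H\<close> (with the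
  quotient topology) onto \<open>L\<close>. For \<open>L = G/H\<close> being Hausdorff is the same as \<open>H\<close> being closed,
  that is, for a Lie group \<open>G\<close>, as \<open>G/H\<close> being a manifold. The action is effective because
  \<open>\<phi>\<close> is injective, and transitive because \<open>Mult L\<close> contains the translations.\<close>

definition is_multiplication_group ::
  "('g, 'c) monoid_scheme \<Rightarrow> 'g topology \<Rightarrow> ('a, 'b) monoid_scheme \<Rightarrow> 'a topology \<Rightarrow> bool" where
  "is_multiplication_group G S L T \<longleftrightarrow>
     Hausdorff_space T \<and>
     (\<exists>\<phi>. \<phi> \<in> iso G (Mult L) \<and>
          continuous_map (prod_topology S T) T (\<lambda>(g, x). \<phi> g x) \<and>
          quotient_map S T (\<lambda>g. \<phi> g (\<one>\<^bsub>L\<^esub>)))"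

definition G_matrix :: "real \<Rightarrow> real \<Rightarrow> real \<Rightarrow> real \<Rightarrow> real \<Rightarrow> real^4^4" where
  "G_matrix a x1 x2 x3 x4 = vector
     [vector [exp (a * x4), 0, 0, x1],
      vector [0, exp x4, x4 * exp x4, x2],
      vector [0, 0, exp x4, x3],
      vector [0, 0, 0, 1]]"

definition G_group :: "real \<Rightarrow> (real^4^4) monoid" where
  "G_group a = \<lparr>carrier = {G_matrix a x1 x2 x3 x4 | x1 x2 x3 x4. True},
                monoid.mult = (**), one = mat 1\<rparr>"

abbreviation G_topology :: "real \<Rightarrow> (real^4^4) topology" where
  "G_topology a \<equiv> top_of_set (carrier (G_group a))"

end

theory Submission
  imports Defs
begin

text \<open>Write \<open>V = \<real>\<^sup>3\<close> and let \<open>M t\<close> be the linear flow by which the \<open>x\<^sub>4\<close>-line acts on \<open>V\<close>, so that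
  \<open>G\<close> is the semidirect product with \<open>(v, t) (w, s) = (v + M t w, t + s)\<close>. As \<open>a \<noteq> 0\<close>, the map
  \<open>M t - 1\<close> is invertible for every \<open>t \<noteq> 0\<close>; in particular \<open>G\<close> has trivial centre. Suppose that
  \<open>G = Mult L\<close>, and let \<open>H\<close> be the stabilizer of the identity \<open>e\<close> of \<open>L\<close> and \<open>K = H \<inter> V\<close>. It is shown
  that \<open>L\<close> is a group.

  Three facts restrict \<open>H\<close>. A point of \<open>L\<close> fixed by all of \<open>H\<close> lies in the centre of the loop, so
  that its translation is central in \<open>G\<close>; hence \<open>e\<close> is the only such point (\<open>stab_fixed_point\<close>)
  and \<open>H\<close> is its own normalizer (\<open>stab_normalizer\<close>). The action is effective, so \<open>H\<close> contains no
  nontrivial normal subgroup of \<open>G\<close> (\<open>stab_core_free\<close>). Finally, if \<open>H\<close> is countable then \<open>L\<close> is a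
  group (\<open>countable_stab_imp_group\<close>): for fixed \<open>y\<close>, \<open>z\<close> the point \<open>y \ (x \ ((x y) z))\<close> lies in the countable
  orbit \<open>H z\<close>, and it moves continuously along a path from \<open>e\<close> to \<open>x\<close>; so it
  is constant, and it is \<open>z\<close> for \<open>x = e\<close>.

  If \<open>H \<subseteq> V\<close>, the abelian group \<open>V\<close> normalizes \<open>H\<close>, whence \<open>H = V\<close> is normal, which is
  absurd. So \<open>H\<close> has an element \<open>(v\<^sub>0, t\<^sub>0)\<close> with \<open>t\<^sub>0 \<noteq> 0\<close>. The closed group \<open>K\<close> is countable, since otherwise
  it contains a line, the directions of the lines in \<open>K\<close> form an \<open>M t\<^sub>0\<close>-invariant subspace, and such a
  subspace contains a common eigenvector of all \<open>M t\<close>, which spans a normal subgroup of \<open>G\<close>.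

  If \<open>K\<close> contains some \<open>k \<noteq> 0\<close>, then each \<open>(v, t) \<in> H\<close> gives an element \<open>M t k\<close> of the countable
  set \<open>K\<close>, and these are distinct for distinct \<open>t\<close>. So \<open>H\<close> is countable and \<open>L\<close> is a group.
  If \<open>K = 0\<close>, then \<open>H\<close> is abelian, so it fixes the point \<open>p\<close> of \<open>V\<close> fixed by the affine
  map \<open>(v\<^sub>0, t\<^sub>0)\<close>. The stabilizer of \<open>p\<close> in \<open>G\<close> is abelian and so normalizes \<open>H\<close>,
  hence equals \<open>H\<close>, and \<open>L\<close> is identified with \<open>V\<close> in such a way
  that \<open>x y = x + M (f x) y = y + M (g y) x\<close>. The first coordinate with \<open>y\<close> a unit
  vector gives \<open>exp (a f x) - 1 = c x\<^sub>1\<close> for a constant \<open>c\<close>. Here the left side is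
  larger than \<open>-1\<close> and \<open>x\<^sub>1\<close> is arbitrary, so \<open>c = 0\<close>. Hence \<open>f = 0\<close>, and \<open>L\<close> is the
  vector group \<open>V\<close>.\<close>

section \<open>The group as a semidirect product\<close>

definition flow :: "real \<Rightarrow> real \<Rightarrow> real \<times> real \<times> real \<Rightarrow> real \<times> real \<times> real" where
  "flow a t v = (case v of (x, y, z) \<Rightarrow>
     (exp (a * t) * x, exp t * y + t * exp t * z, exp t * z))"

definition G_elem :: "real \<Rightarrow> real \<times> real \<times> real \<Rightarrow> real \<Rightarrow> real^4^4" where
  "G_elem a v t = (case v of (x, y, z) \<Rightarrow> G_matrix a x y z t)"

lemma flow_0 [simp]: "flow a 0 v = v"
  by (cases v) (simp add: flow_def)

lemma flow_zero [simp]: "flow a t 0 = 0"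
  by (simp add: flow_def zero_prod_def)

lemma flow_add: "flow a t (v + w) = flow a t v + flow a t w"
  by (cases v; cases w) (simp add: flow_def algebra_simps)

lemma flow_diff: "flow a t (v - w) = flow a t v - flow a t w"
  by (cases v; cases w) (simp add: flow_def algebra_simps)

lemma flow_uminus: "flow a t (- v) = - flow a t v"
  by (cases v) (simp add: flow_def algebra_simps)

lemma flow_scaleR: "flow a t (r *\<^sub>R v) = r *\<^sub>R flow a t v"
  by (cases v) (simp add: flow_def algebra_simps)

lemma flow_flow: "flow a t (flow a s v) = flow a (t + s) v"
  by (cases v) (simp add: flow_def exp_add algebra_simps)

text \<open>The eigenvalues of the flow at time \<open>t\<close> are \<open>exp (a t)\<close> and \<open>exp t\<close>, so 1 is among them only
  at time 0. This is where \<open>a \<noteq> 0\<close> enters; it also gives the surjectivity below, by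
  which an affine map with linear part \<open>flow a t\<close>, \<open>t \<noteq> 0\<close>, has a fixed point \<open>p\<close>.\<close>

lemma flow_fixes_imp_zero:
  assumes "a \<noteq> 0" "flow a t v = v" "v \<noteq> 0"
  shows "t = 0"
proof (rule ccontr)
  assume "t \<noteq> 0"
  obtain x y z where v: "v = (x, y, z)" by (cases v)
  have "exp (a * t) \<noteq> 1" "exp t \<noteq> 1"
    using \<open>t \<noteq> 0\<close> \<open>a \<noteq> 0\<close> by auto
  moreover have eqs: "exp (a * t) * x = x" "exp t * y + t * exp t * z = y" "exp t * z = z"
    using assms(2) by (auto simp: v flow_def)
  ultimately have "x = 0" "z = 0" by auto
  then have "y = 0" using eqs \<open>exp t \<noteq> 1\<close> by auto
  with \<open>x = 0\<close> \<open>z = 0\<close> \<open>v \<noteq> 0\<close> show False by (simp add: v zero_prod_def)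
qed

lemma id_minus_flow_surj:
  assumes "a \<noteq> 0" "t \<noteq> 0"
  obtains p where "v = p - flow a t p"
proof -
  obtain x y z where v: "v = (x, y, z)" by (cases v)
  have 1: "1 - exp (a * t) \<noteq> 0" "1 - exp t \<noteq> 0"
    using assms by auto
  define z' where "z' = z / (1 - exp t)"
  define y' where "y' = (y + t * exp t * z') / (1 - exp t)"
  define x' where "x' = x / (1 - exp (a * t))"
  have "z = (1 - exp t) * z'" "y = (1 - exp t) * y' - t * exp t * z'" "x = (1 - exp (a * t)) * x'"
    using 1 by (simp_all add: z'_def y'_def x'_def)
  then have "v = (x', y', z') - flow a t (x', y', z')"
    by (simp add: v flow_def algebra_simps)
  then show thesis by (rule that)
qed

lemma vector_4 [simp]:
  "(vector [x, y, z, w] :: 'b::zero^4) $ 1 = x"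
  "(vector [x, y, z, w] :: 'b::zero^4) $ 2 = y"
  "(vector [x, y, z, w] :: 'b::zero^4) $ 3 = z"
  "(vector [x, y, z, w] :: 'b::zero^4) $ 4 = w"
  unfolding vector_def by simp_all

lemma G_elem_mult: "G_elem a v t ** G_elem a w s = G_elem a (v + flow a t w) (t + s)"
  by (cases v; cases w)
    (simp add: G_elem_def G_matrix_def flow_def vec_eq_iff forall_4 matrix_matrix_mult_def sum_4
      exp_add algebra_simps)

lemma G_elem_inject: "G_elem a v t = G_elem a w s \<longleftrightarrow> v = w \<and> t = s"
  by (cases v; cases w) (auto simp: G_elem_def G_matrix_def vec_eq_iff forall_4)

lemma carrier_G_group: "carrier (G_group a) = range (\<lambda>(v, t). G_elem a v t)"
  by (auto simp: G_group_def G_elem_def image_def)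

lemma mult_G_group [simp]: "x \<otimes>\<^bsub>G_group a\<^esub> y = x ** y"
  by (simp add: G_group_def)

lemma G_elem_closed [simp]: "G_elem a v t \<in> carrier (G_group a)"
  by (auto simp: carrier_G_group)

lemma continuous_on_vector_4:
  fixes f g h k :: "'b::topological_space \<Rightarrow> 'c::{zero, topological_space}"
  assumes "continuous_on S f" "continuous_on S g" "continuous_on S h" "continuous_on S k"
  shows "continuous_on S (\<lambda>p. vector [f p, g p, h p, k p] :: 'c^4)"
  unfolding continuous_on_def
proof (intro ballI vec_tendstoI)
  fix x i assume "x \<in> S"
  then have "\<forall>i. ((\<lambda>p. (vector [f p, g p, h p, k p] :: 'c^4) $ i) \<longlongrightarrow>
      (vector [f x, g x, h x, k x] :: 'c^4) $ i) (at x within S)"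
    using assms by (simp add: continuous_on_def forall_4)
  then show "((\<lambda>p. (vector [f p, g p, h p, k p] :: 'c^4) $ i) \<longlongrightarrow>
      (vector [f x, g x, h x, k x] :: 'c^4) $ i) (at x within S)" ..
qed

lemma continuous_on_G_elem: "continuous_on UNIV (\<lambda>(v, t). G_elem a v t)"
  unfolding G_elem_def G_matrix_def split_beta
  by (intro continuous_on_vector_4 continuous_intros)

lemma G_center_trivial:
  assumes "a \<noteq> 0"
    and comm: "\<And>w s. G_elem a v t ** G_elem a w s = G_elem a w s ** G_elem a v t"
  shows "v = 0 \<and> t = 0"
proof -
  have eq: "v + flow a t w = w + flow a s v" for w s
    using comm[of w s] by (simp add: G_elem_mult G_elem_inject)
  have "flow a t (1, 1, 1) = (1, 1, 1)" using eq[of "(1, 1, 1)" 0] by simp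
  then have "t = 0" using flow_fixes_imp_zero[OF \<open>a \<noteq> 0\<close>] by (simp add: zero_prod_def)
  moreover have "flow a 1 v = v" using eq[of 0 1] by simp
  then have "v = 0" using flow_fixes_imp_zero[OF \<open>a \<noteq> 0\<close>] by fastforce
  ultimately show ?thesis by simp
qed

section \<open>Closed subgroups of a Euclidean space\<close>

text \<open>An uncountable set has a limit point, so differences of its elements give nonzero \<open>k\<^sub>n \<in> K\<close>
  tending to 0. If \<open>u\<close> is a limit of the directions \<open>k\<^sub>n / |k\<^sub>n|\<close>, every \<open>r u\<close> is the limit of integer
  multiples of the \<open>k\<^sub>n\<close>, because the multiples of \<open>k\<^sub>n\<close> have spacing \<open>|k\<^sub>n|\<close>.\<close>

lemma uncountable_closed_subgroup_contains_line:
  fixes K :: "'b::euclidean_space set"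
  assumes "closed K" "uncountable K"
    and diff: "\<And>v w. v \<in> K \<Longrightarrow> w \<in> K \<Longrightarrow> v - w \<in> K"
  obtains u where "u \<noteq> 0" "\<And>r. r *\<^sub>R u \<in> K"
proof -
  obtain z where z: "z islimpt K"
    using no_limpt_imp_countable[of K] \<open>uncountable K\<close> by blast
  have zero: "0 \<in> K"
    using diff \<open>uncountable K\<close> by (metis countable_empty diff_self ex_in_conv)
  have minus: "- v \<in> K" if "v \<in> K" for v
    using diff[OF zero that] by simp
  have plus: "v + w \<in> K" if "v \<in> K" "w \<in> K" for v w
    using diff[OF that(1) minus[OF that(2)]] by simp
  have nat_mult: "of_nat n *\<^sub>R v \<in> K" if "v \<in> K" for v and n :: nat
    by (induction n) (auto simp: zero plus that scaleR_add_left)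
  have int_mult: "of_int i *\<^sub>R v \<in> K" if "v \<in> K" for v and i :: int
  proof (cases i rule: int_cases2)
    case (nonneg n)
    then show ?thesis using nat_mult[OF that] by simp
  next
    case (nonpos n)
    then show ?thesis using minus[OF nat_mult[OF that]] by simp
  qed
  have "\<exists>k\<in>K. k \<noteq> 0 \<and> norm k < e" if "e > 0" for e
  proof -
    obtain v where v: "v \<in> K" "v \<noteq> z" "dist v z < e / 2"
      using z \<open>e > 0\<close> unfolding islimpt_approachable by (meson half_gt_zero)
    obtain w where w: "w \<in> K" "w \<noteq> z" "dist w z < min (e / 2) (dist v z)"
      using z \<open>e > 0\<close> v unfolding islimpt_approachable
      by (metis half_gt_zero min_less_iff_conj zero_less_dist_iff)
    have "norm (v - w) < e"
      using v w dist_triangle2[of v w z] by (simp add: dist_norm)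
    moreover have "v \<noteq> w" using w by auto
    ultimately show ?thesis using diff[OF v(1) w(1)] by (intro bexI[of _ "v - w"]) auto
  qed
  then have "\<forall>n. \<exists>k. k \<in> K \<and> k \<noteq> 0 \<and> norm k < inverse (real (Suc n))"
    by (metis inverse_positive_iff_positive of_nat_0_less_iff zero_less_Suc)
  then obtain k where k: "\<And>n. k n \<in> K" "\<And>n. k n \<noteq> 0" "\<And>n. norm (k n) < inverse (real (Suc n))"
    by metis
  have k0: "(\<lambda>n. norm (k n)) \<longlonglongrightarrow> 0"
    by (rule real_tendsto_sandwich[OF _ _ tendsto_const LIMSEQ_inverse_real_of_nat])
      (use k(3) in \<open>auto intro!: always_eventually less_imp_le simp del: of_nat_Suc\<close>)
  have "\<forall>n. sgn (k n) \<in> sphere 0 1"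
    using k by (simp add: norm_sgn)
  then obtain u \<sigma> where u: "u \<in> sphere 0 1" and \<sigma>: "strict_mono \<sigma>"
    and lim: "((\<lambda>n. sgn (k n)) \<circ> \<sigma>) \<longlonglongrightarrow> u"
    using compact_sphere[of 0 1, unfolded compact_def] by metis
  have k0': "(\<lambda>n. norm (k (\<sigma> n))) \<longlonglongrightarrow> 0"
    using LIMSEQ_subseq_LIMSEQ[OF k0 \<sigma>] by (simp add: o_def)
  show thesis
  proof
    show "u \<noteq> 0" using u by auto
    fix r :: real
    \<comment> \<open>\<open>c n\<close> is the multiple of \<open>norm (k (\<sigma> n))\<close> just below \<open>r\<close>.\<close>
    define c where "c n = of_int \<lfloor>r / norm (k (\<sigma> n))\<rfloor> * norm (k (\<sigma> n))" for n
    have c: "r - norm (k (\<sigma> n)) \<le> c n" "c n \<le> r" for n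
    proof -
      have pos: "norm (k (\<sigma> n)) > 0" using k by simp
      show "c n \<le> r" unfolding c_def
        using pos by (metis of_int_floor_le pos_le_divide_eq)
      have "r / norm (k (\<sigma> n)) - 1 \<le> of_int \<lfloor>r / norm (k (\<sigma> n))\<rfloor>"
        by linarith
      then have "(r / norm (k (\<sigma> n)) - 1) * norm (k (\<sigma> n)) \<le> c n"
        unfolding c_def using pos by (intro mult_right_mono) auto
      then show "r - norm (k (\<sigma> n)) \<le> c n" using pos k(2) by (simp add: algebra_simps)
    qed
    have "c \<longlonglongrightarrow> r"
    proof (rule real_tendsto_sandwich)
      show "(\<lambda>n. r - norm (k (\<sigma> n))) \<longlonglongrightarrow> r"
        using tendsto_diff[OF tendsto_const k0', of r] by simp
    qed (use c in auto)
    then have "(\<lambda>n. c n *\<^sub>R sgn (k (\<sigma> n))) \<longlonglongrightarrow> r *\<^sub>R u"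
      using lim by (intro tendsto_scaleR) (auto simp: o_def)
    moreover have "\<forall>n. c n *\<^sub>R sgn (k (\<sigma> n)) \<in> K"
    proof
      fix n
      have "c n *\<^sub>R sgn (k (\<sigma> n)) = of_int \<lfloor>r / norm (k (\<sigma> n))\<rfloor> *\<^sub>R k (\<sigma> n)"
        using k(2) by (simp add: c_def sgn_div_norm)
      then show "c n *\<^sub>R sgn (k (\<sigma> n)) \<in> K" using int_mult k(1) by simp
    qed
    ultimately show "r *\<^sub>R u \<in> K"
      using closed_sequentially[OF \<open>closed K\<close>] by fast
  qed
qed

section \<open>Continuous curves with countable image\<close>

text \<open>The range of \<open>F\<close> is a path connected \<open>T\<^sub>1\<close> space, and by Sierpinski's theorem such a space is
  uncountable unless it is a point.\<close>

lemma continuous_countable_range_constant: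
  fixes F :: "real \<Rightarrow> 'b"
  assumes F: "continuous_map euclideanreal T F" and "t1_space T" "countable (range F)"
  shows "F s = F t"
proof -
  have "path_connectedin T (range F)"
    using path_connectedin_continuous_map_image[OF F, of UNIV]
    by (simp add: convex_imp_path_connected)
  then have "path_connected_space (subtopology T (range F))" and sub: "range F \<subseteq> topspace T"
    by (auto simp: path_connectedin_def)
  then have "\<exists>c. topspace (subtopology T (range F)) \<subseteq> {c}"
    using path_connected_space_imp_uncountable t1_space_subtopology assms
    by (metis countable_Int2 topspace_subtopology)
  then obtain c where "topspace T \<inter> range F \<subseteq> {c}"
    by auto
  then have "F \<tau> = c" for \<tau>
    using sub by blast
  then show ?thesis by simp
qed

section \<open>Loops\<close>

context loop
begin

lemma ldiv: "a \<in> carrier L \<Longrightarrow> b \<in> carrier L \<Longrightarrow>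
    loop_ldiv L a b \<in> carrier L \<and> a \<otimes> loop_ldiv L a b = b"
  unfolding loop_ldiv_def by (rule theI'[OF left_div_unique])

lemma rdiv: "a \<in> carrier L \<Longrightarrow> b \<in> carrier L \<Longrightarrow>
    loop_rdiv L b a \<in> carrier L \<and> loop_rdiv L b a \<otimes> a = b"
  unfolding loop_rdiv_def by (rule theI'[OF right_div_unique])

lemma left_cancel: "\<lbrakk>a \<in> carrier L; x \<in> carrier L; y \<in> carrier L; a \<otimes> x = a \<otimes> y\<rbrakk> \<Longrightarrow> x = y"
  using left_div_unique[of a "a \<otimes> x"] mult_closed by metis

lemma right_cancel: "\<lbrakk>a \<in> carrier L; x \<in> carrier L; y \<in> carrier L; x \<otimes> a = y \<otimes> a\<rbrakk> \<Longrightarrow> x = y"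
  using right_div_unique[of a "x \<otimes> a"] mult_closed by metis

lemma ldiv_self: "x \<in> carrier L \<Longrightarrow> loop_ldiv L x x = \<one>"
  using ldiv[of x x] left_cancel[of x _ \<one>] right_one one_closed by metis

lemma ldiv_mult: "x \<in> carrier L \<Longrightarrow> y \<in> carrier L \<Longrightarrow> loop_ldiv L x (x \<otimes> y) = y"
  using ldiv[of x "x \<otimes> y"] left_cancel[of x _ y] mult_closed by metis

lemma rdiv_self: "x \<in> carrier L \<Longrightarrow> loop_rdiv L x x = \<one>"
  using rdiv[of x x] right_cancel[of x _ \<one>] left_one one_closed by metis

lemma rdiv_mult: "x \<in> carrier L \<Longrightarrow> y \<in> carrier L \<Longrightarrow> loop_rdiv L (y \<otimes> x) x = y"
  using rdiv[of x "y \<otimes> x"] right_cancel[of x _ y] mult_closed by metis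

lemma associative_imp_group:
  assumes "\<And>x y z. \<lbrakk>x \<in> carrier L; y \<in> carrier L; z \<in> carrier L\<rbrakk>
     \<Longrightarrow> (x \<otimes> y) \<otimes> z = x \<otimes> (y \<otimes> z)"
  shows "group L"
proof (rule groupI)
  fix x assume x: "x \<in> carrier L"
  show "\<exists>y\<in>carrier L. y \<otimes> x = \<one>"
    using rdiv[OF x one_closed] by blast
qed (simp_all add: assms mult_closed one_closed left_one)

lemma left_translation_bij: "x \<in> carrier L \<Longrightarrow> left_translation L x \<in> Bij (carrier L)"
  unfolding Bij_def left_translation_def
  by (auto intro!: bij_betw_byWitness[where f' = "\<lambda>y. loop_ldiv L x y"]
      simp: mult_closed ldiv ldiv_mult)

lemma right_translation_bij: "x \<in> carrier L \<Longrightarrow> right_translation L x \<in> Bij (carrier L)"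
  unfolding Bij_def right_translation_def
  by (auto intro!: bij_betw_byWitness[where f' = "\<lambda>y. loop_rdiv L y x"]
      simp: mult_closed rdiv rdiv_mult)

lemma carrier_Mult:
  "carrier (Mult L) = generate (BijGroup (carrier L))
     (left_translation L ` carrier L \<union> right_translation L ` carrier L)"
proof -
  have "left_translation L ` carrier L \<union> right_translation L ` carrier L
      \<subseteq> carrier (BijGroup (carrier L))"
    by (auto simp: BijGroup_def left_translation_bij right_translation_bij)
  then show ?thesis
    by (simp add: Mult_def carrier_subgroup_generated Int_absorb1)
qed

lemma mult_Mult: "f \<otimes>\<^bsub>Mult L\<^esub> g = f \<otimes>\<^bsub>BijGroup (carrier L)\<^esub> g"
  by (simp add: Mult_def subgroup_generated_def)

lemma Mult_subset_Bij: "carrier (Mult L) \<subseteq> Bij (carrier L)"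
  unfolding carrier_Mult
proof
  fix f
  assume "f \<in> generate (BijGroup (carrier L))
     (left_translation L ` carrier L \<union> right_translation L ` carrier L)"
  then have "f \<in> carrier (BijGroup (carrier L))"
    by (intro group.generate_in_carrier[OF group_BijGroup])
      (auto simp: BijGroup_def left_translation_bij right_translation_bij)
  then show "f \<in> Bij (carrier L)" by (simp add: BijGroup_def)
qed

text \<open>The centralizer of a permutation is a group, so commuting with the generators of the
  multiplication group is enough.\<close>

lemma commutes_with_Mult:
  assumes c: "c \<in> carrier (Mult L)"
    and left: "\<And>x y. x \<in> carrier L \<Longrightarrow> y \<in> carrier L \<Longrightarrow> c (x \<otimes> y) = x \<otimes> c y"
    and right: "\<And>x y. x \<in> carrier L \<Longrightarrow> y \<in> carrier L \<Longrightarrow> c (y \<otimes> x) = c y \<otimes> x"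
    and f: "f \<in> carrier (Mult L)" and "y \<in> carrier L"
  shows "c (f y) = f (c y)"
proof -
  let ?B = "BijGroup (carrier L)"
  have cB: "c \<in> Bij (carrier L)" using c Mult_subset_Bij by blast
  then have cc: "c y \<in> carrier L" if "y \<in> carrier L" for y
    using Bij_imp_funcset that by blast
  have tr: "h \<in> Bij (carrier L) \<and> (\<forall>y\<in>carrier L. c (h y) = h (c y))"
    if "h \<in> left_translation L ` carrier L \<union> right_translation L ` carrier L" for h
    using that
  proof
    assume "h \<in> left_translation L ` carrier L"
    then show ?thesis
      using left_translation_bij cc by (auto simp: left_translation_def left mult_closed)
  next
    assume "h \<in> right_translation L ` carrier L"
    then show ?thesis
      using right_translation_bij cc by (auto simp: right_translation_def right mult_closed)
  qed
  have "f \<in> Bij (carrier L) \<and> (\<forall>y\<in>carrier L. c (f y) = f (c y))"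
    using f unfolding carrier_Mult
  proof induction
    case one
    have "\<one>\<^bsub>?B\<^esub> = (\<lambda>x\<in>carrier L. x)" by (simp add: BijGroup_def)
    then show ?case using id_Bij[of "carrier L"] cc by (metis restrict_apply')
  next
    case (incl h)
    then show ?case by (rule tr)
  next
    case (inv h)
    define g where "g = restrict (inv_into (carrier L) h) (carrier L)"
    have h: "h \<in> Bij (carrier L)" "\<And>y. y \<in> carrier L \<Longrightarrow> c (h y) = h (c y)"
      using tr[OF inv] by auto
    have g: "inv\<^bsub>?B\<^esub> h = g" "g \<in> Bij (carrier L)"
      using h(1) by (simp_all add: g_def inv_BijGroup restrict_inv_into_Bij)
    have hg: "g y \<in> carrier L \<and> h (g y) = y \<and> g (h y) = y" if "y \<in> carrier L" for y
    proof -
      have bij: "bij_betw h (carrier L) (carrier L)" using h(1) by (simp add: Bij_def)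
      then have "h y \<in> carrier L" "g y \<in> carrier L"
        using that Bij_imp_funcset[OF g(2)] bij_betwE by blast+
      then show ?thesis
        using that bij_betw_inv_into_left[OF bij that] bij_betw_inv_into_right[OF bij that]
        by (simp add: g_def)
    qed
    have "c (g y) = g (c y)" if "y \<in> carrier L" for y
    proof -
      have "g (c (h (g y))) = g (h (c (g y)))" using h(2)[of "g y"] hg[OF that] by metis
      then show ?thesis using hg[OF that] hg[OF cc[of "g y"]] by simp
    qed
    then show ?case using g by simp
  next
    case (eng f g)
    then have g: "g y \<in> carrier L" if "y \<in> carrier L" for y
      using that Bij_imp_funcset by blast
    have "f \<otimes>\<^bsub>?B\<^esub> g = compose (carrier L) f g"
      using eng by (simp add: BijGroup_def)
    then show ?case
      using eng g cc compose_Bij[of f "carrier L" g] by (simp add: compose_eq)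
  qed
  then show ?thesis using \<open>y \<in> carrier L\<close> by blast
qed

end

section \<open>The action of the group on the loop\<close>

locale loop_with_mult_group_G = topological_loop L T for L :: "'a monoid" (structure) and T +
  fixes a :: real and \<phi>
  assumes a_nonzero: "a \<noteq> 0"
    and Hausdorff: "Hausdorff_space T"
    and iso: "\<phi> \<in> iso (G_group a) (Mult L)"
    and orbit_map: "quotient_map (G_topology a) T (\<lambda>g. \<phi> g \<one>)"
begin

abbreviation act :: "real \<times> real \<times> real \<Rightarrow> real \<Rightarrow> 'a \<Rightarrow> 'a" where
  "act v t \<equiv> \<phi> (G_elem a v t)"

lemma act_Mult: "act v t \<in> carrier (Mult L)"
  using iso by (auto simp: iso_def hom_def)

lemma act_Bij: "act v t \<in> Bij (carrier L)"
  using act_Mult Mult_subset_Bij by blast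

lemma act_closed [simp]: "x \<in> carrier L \<Longrightarrow> act v t x \<in> carrier L"
  using Bij_imp_funcset[OF act_Bij] by blast

lemma act_act: "x \<in> carrier L \<Longrightarrow> act v t (act w s x) = act (v + flow a t w) (t + s) x"
proof -
  assume x: "x \<in> carrier L"
  have "\<phi> (G_elem a v t ** G_elem a w s) = act v t \<otimes>\<^bsub>Mult L\<^esub> act w s"
    using iso hom_mult[of \<phi> "G_group a" "Mult L" "G_elem a v t" "G_elem a w s"]
    by (simp add: iso_def)
  then show ?thesis
    using x by (simp add: mult_Mult BijGroup_def act_Bij compose_def G_elem_mult)
qed

lemma act_zero [simp]:
  assumes "x \<in> carrier L"
  shows "act 0 0 x = x"
proof -
  have "act 0 0 (act 0 0 x) = act 0 0 x" using assms act_act by simp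
  then show ?thesis
    using act_Bij[of 0 0] assms by (auto simp: Bij_def bij_betw_def dest: inj_onD)
qed

lemma act_effective:
  assumes "\<And>y. y \<in> carrier L \<Longrightarrow> act v t y = act w s y"
  shows "v = w \<and> t = s"
proof -
  have "act v t = act w s"
    by (rule extensionalityI[OF Bij_imp_extensional[OF act_Bij] Bij_imp_extensional[OF act_Bij]])
      (rule assms)
  moreover have "inj_on \<phi> (carrier (G_group a))"
    using iso by (auto simp: iso_def bij_betw_def)
  ultimately have "G_elem a v t = G_elem a w s"
    by (auto dest: inj_onD)
  then show ?thesis by (simp add: G_elem_inject)
qed

text \<open>A map that agrees on the loop with an element of \<open>Mult L\<close>. Unlike \<open>Mult L\<close> itself, the predicate
  does not ask for functions to be undefined outside the carrier, so that it applies directly to maps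
  written as loop terms.\<close>

definition in_Mult :: "('a \<Rightarrow> 'a) \<Rightarrow> bool" where
  "in_Mult f \<longleftrightarrow> (\<exists>v t. \<forall>y\<in>carrier L. f y = act v t y)"

lemma in_Mult_if_carrier:
  assumes "g \<in> carrier (Mult L)" "\<And>y. y \<in> carrier L \<Longrightarrow> f y = g y"
  shows "in_Mult f"
proof -
  have "g \<in> \<phi> ` carrier (G_group a)"
    using iso assms(1) by (auto simp: iso_def bij_betw_def)
  then show ?thesis
    using assms(2) by (auto simp: in_Mult_def carrier_G_group)
qed

lemma in_Mult_left:
  assumes "x \<in> carrier L"
  shows "in_Mult (\<lambda>y. x \<otimes> y)"
proof (rule in_Mult_if_carrier)
  show "left_translation L x \<in> carrier (Mult L)"
    unfolding carrier_Mult using assms by (intro generate.incl) blast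
qed (simp add: left_translation_def)

lemma in_Mult_right:
  assumes "x \<in> carrier L"
  shows "in_Mult (\<lambda>y. y \<otimes> x)"
proof (rule in_Mult_if_carrier)
  show "right_translation L x \<in> carrier (Mult L)"
    unfolding carrier_Mult using assms by (intro generate.incl) blast
qed (simp add: right_translation_def)

lemma in_Mult_comp:
  assumes "in_Mult f" "in_Mult g"
  shows "in_Mult (\<lambda>y. f (g y))"
proof -
  obtain v t where "\<And>y. y \<in> carrier L \<Longrightarrow> f y = act v t y"
    using assms(1) unfolding in_Mult_def by blast
  moreover obtain w s where "\<And>y. y \<in> carrier L \<Longrightarrow> g y = act w s y"
    using assms(2) unfolding in_Mult_def by blast
  ultimately have "f (g y) = act (v + flow a t w) (t + s) y" if "y \<in> carrier L" for y
    using that by (simp add: act_act)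
  then show ?thesis unfolding in_Mult_def by blast
qed

lemma act_inverse:
  assumes "x \<in> carrier L" "act v t x = y"
  shows "x = act (- flow a (- t) v) (- t) y"
  using assms act_act[OF assms(1), of "- flow a (- t) v" "- t" v t] by simp

lemma in_Mult_inverse:
  assumes "in_Mult f" "\<And>y. y \<in> carrier L \<Longrightarrow> g y \<in> carrier L \<and> f (g y) = y"
  shows "in_Mult g"
proof -
  obtain v t where f: "\<And>y. y \<in> carrier L \<Longrightarrow> f y = act v t y"
    using assms(1) unfolding in_Mult_def by blast
  have "g y = act (- flow a (- t) v) (- t) y" if "y \<in> carrier L" for y
    using act_inverse[of "g y" v t y] assms(2)[OF that] f[of "g y"] by simp
  then show ?thesis unfolding in_Mult_def by blast
qed

lemma in_Mult_ldiv:
  assumes x: "x \<in> carrier L"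
  shows "in_Mult (\<lambda>y. loop_ldiv L x y)"
proof (rule in_Mult_inverse)
  show "in_Mult (\<lambda>y. x \<otimes> y)" using x by (rule in_Mult_left)
qed (use x ldiv in blast)

lemma in_Mult_rdiv:
  assumes x: "x \<in> carrier L"
  shows "in_Mult (\<lambda>y. loop_rdiv L y x)"
proof (rule in_Mult_inverse)
  show "in_Mult (\<lambda>y. y \<otimes> x)" using x by (rule in_Mult_right)
qed (use x rdiv in blast)

lemma act_transitive:
  assumes "x \<in> carrier L"
  obtains v t where "x = act v t \<one>"
proof -
  obtain v t where "\<And>y. y \<in> carrier L \<Longrightarrow> x \<otimes> y = act v t y"
    using in_Mult_left[OF assms] unfolding in_Mult_def by blast
  from this[OF one_closed] show thesis using right_one[OF assms] that by simp
qed

text \<open>The stabilizer of the identity, as a set of pairs \<open>(v, t)\<close>. It is the inner mapping group of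
  the loop.\<close>

definition stab :: "((real \<times> real \<times> real) \<times> real) set" where
  "stab = {(v, t). act v t \<one> = \<one>}"

lemma stab_mult: "(v, t) \<in> stab \<Longrightarrow> (w, s) \<in> stab \<Longrightarrow> (v + flow a t w, t + s) \<in> stab"
  using act_act[OF one_closed, of v t w s] by (simp add: stab_def)

lemma stab_inverse: "(v, t) \<in> stab \<Longrightarrow> (- flow a (- t) v, - t) \<in> stab"
  using act_inverse[OF one_closed, of v t \<one>] by (simp add: stab_def)

lemma inner_in_stab:
  assumes "in_Mult f" "f \<one> = \<one>"
  obtains v t where "(v, t) \<in> stab" "\<And>y. y \<in> carrier L \<Longrightarrow> f y = act v t y"
proof -
  obtain v t where vt: "\<And>y. y \<in> carrier L \<Longrightarrow> f y = act v t y"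
    using assms(1) unfolding in_Mult_def by blast
  then have "(v, t) \<in> stab" using assms(2) one_closed by (simp add: stab_def)
  then show thesis using vt by (rule that)
qed

text \<open>Three families of inner mappings carry the argument: \<open>u \<mapsto> y \ (u y)\<close>, \<open>u \<mapsto> z \ (y \ ((y z) u))\<close> and
  \<open>u \<mapsto> ((u y) z) / (y z)\<close>. That they fix \<open>x\<close> says that \<open>x\<close> commutes and associates with all elements.
  Then the translation by \<open>x\<close> commutes with all translations, so it comes from the
  trivial centre of \<open>G\<close>.\<close>

lemma stab_fixed_point:
  assumes x: "x \<in> carrier L" and fixed: "\<And>v t. (v, t) \<in> stab \<Longrightarrow> act v t x = x"
  shows "x = \<one>"
proof -
  have inner: "f x = x" if "in_Mult f" "f \<one> = \<one>" for f
    by (rule inner_in_stab[OF that]) (use fixed x in auto)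
  have comm: "x \<otimes> y = y \<otimes> x" if y: "y \<in> carrier L" for y
  proof -
    have "loop_ldiv L y (x \<otimes> y) = x"
      by (rule inner) (use y in_Mult_comp[OF in_Mult_ldiv in_Mult_right] ldiv_self left_one in auto)
    then show ?thesis using ldiv[of y "x \<otimes> y"] x y mult_closed by simp
  qed
  have assoc1: "(y \<otimes> z) \<otimes> x = y \<otimes> (z \<otimes> x)" if y: "y \<in> carrier L" and z: "z \<in> carrier L" for y z
  proof -
    have "loop_ldiv L z (loop_ldiv L y ((y \<otimes> z) \<otimes> x)) = x"
      by (rule inner)
        (use y z mult_closed in_Mult_comp[OF in_Mult_ldiv in_Mult_comp[OF in_Mult_ldiv in_Mult_left]]
          right_one ldiv_mult ldiv_self in auto)
    then show ?thesis
      using ldiv[of y "(y \<otimes> z) \<otimes> x"] ldiv[of z "loop_ldiv L y ((y \<otimes> z) \<otimes> x)"] x y z mult_closed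
      by metis
  qed
  have assoc2: "(x \<otimes> y) \<otimes> z = x \<otimes> (y \<otimes> z)" if y: "y \<in> carrier L" and z: "z \<in> carrier L" for y z
  proof -
    have "loop_rdiv L ((x \<otimes> y) \<otimes> z) (y \<otimes> z) = x"
      by (rule inner)
        (use y z mult_closed in_Mult_comp[OF in_Mult_rdiv in_Mult_comp[OF in_Mult_right in_Mult_right]]
          left_one rdiv_self in auto)
    then show ?thesis
      using rdiv[of "y \<otimes> z" "(x \<otimes> y) \<otimes> z"] x y z mult_closed by metis
  qed
  obtain v t where vt: "\<And>y. y \<in> carrier L \<Longrightarrow> x \<otimes> y = act v t y"
    using in_Mult_left[OF x] unfolding in_Mult_def by blast
  have "act v t (act w s y) = act w s (act v t y)" if "y \<in> carrier L" for w s y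
  proof (rule commutes_with_Mult[OF act_Mult _ _ act_Mult that])
    fix y z assume yz: "y \<in> carrier L" "z \<in> carrier L"
    have "x \<otimes> (y \<otimes> z) = y \<otimes> (x \<otimes> z)"
      using assoc1[OF yz] comm[OF yz(2)] comm[OF mult_closed[OF yz]] by simp
    then show "act v t (y \<otimes> z) = y \<otimes> act v t z"
      using vt yz mult_closed by simp
    show "act v t (z \<otimes> y) = act v t z \<otimes> y"
      using assoc2[OF yz(2,1)] vt yz mult_closed by simp
  qed
  then have "act (v + flow a t w) (t + s) y = act (w + flow a s v) (s + t) y"
    if "y \<in> carrier L" for w s y
    using that act_act by simp
  then have "G_elem a v t ** G_elem a w s = G_elem a w s ** G_elem a v t" for w s
    unfolding G_elem_mult G_elem_inject by (rule act_effective)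
  then have "v = 0 \<and> t = 0" by (rule G_center_trivial[OF a_nonzero])
  then show ?thesis
    using vt[OF one_closed] right_one[OF x] one_closed by simp
qed

text \<open>If \<open>g\<close> normalizes the stabilizer \<open>H\<close>, then \<open>H g e = g H e = g e\<close>, so \<open>g e\<close> is a fixed point of \<open>H\<close>. The
  inclusion \<open>H g \<subseteq> g H\<close> suffices for this.\<close>

lemma stab_normalizer:
  assumes "\<And>w s. (w, s) \<in> stab \<Longrightarrow> \<exists>w' s'. (w', s') \<in> stab \<and>
      G_elem a w s ** G_elem a v t = G_elem a v t ** G_elem a w' s'"
  shows "(v, t) \<in> stab"
proof -
  have "act v t \<one> = \<one>"
  proof (rule stab_fixed_point)
    fix w s assume "(w, s) \<in> stab"
    then obtain w' s' where w': "(w', s') \<in> stab"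
      "G_elem a w s ** G_elem a v t = G_elem a v t ** G_elem a w' s'" using assms by blast
    then have "act w s (act v t \<one>) = act v t (act w' s' \<one>)"
      by (simp add: act_act one_closed flip: G_elem_mult)
    then show "act w s (act v t \<one>) = act v t \<one>" using w'(1) by (simp add: stab_def)
  qed (simp add: one_closed)
  then show ?thesis by (simp add: stab_def)
qed

text \<open>The hypothesis says that \<open>H\<close> contains all conjugates of the translation by \<open>u\<close>; so this
  translation fixes every point, and the action is effective.\<close>

lemma stab_core_free:
  assumes "\<And>s. (flow a s u, 0) \<in> stab"
  shows "u = 0"
proof -
  have "act u 0 x = act 0 0 x" if x: "x \<in> carrier L" for x
  proof -
    obtain w s where ws: "x = act w s \<one>" using act_transitive[OF x] .
    have "act u 0 x = act w s (act (flow a (- s) u) 0 \<one>)"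
      by (simp add: ws act_act one_closed flow_flow add.commute)
    also have "act (flow a (- s) u) 0 \<one> = \<one>" using assms[of "- s"] by (simp add: stab_def)
    finally show ?thesis using ws x by simp
  qed
  then show ?thesis using act_effective by blast
qed

text \<open>Translations commute, so they would all normalize a stabilizer consisting of translations and
  therefore lie in it; but \<open>V\<close> is normal in \<open>G\<close>.\<close>

lemma stab_not_translations: obtains v t where "(v, t) \<in> stab" "t \<noteq> 0"
proof (rule ccontr)
  assume "\<not> thesis"
  with that have "\<forall>v t. (v, t) \<in> stab \<longrightarrow> t = 0" by blast
  then have t0: "t = 0" if "(v, t) \<in> stab" for v t using that by blast
  have "(v, 0) \<in> stab" for v
  proof (rule stab_normalizer)
    fix w s assume "(w, s) \<in> stab"
    moreover from this have "s = 0" by (rule t0)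
    ultimately show "\<exists>w' s'. (w', s') \<in> stab \<and>
        G_elem a w s ** G_elem a v 0 = G_elem a v 0 ** G_elem a w' s'"
      by (intro exI[of _ w] exI[of _ s]) (simp add: G_elem_mult add.commute)
  qed
  then have "(1, 1, 1) = (0 :: real \<times> real \<times> real)" by (intro stab_core_free)
  then show False by (simp add: zero_prod_def)
qed

lemma continuous_orbit: "continuous_map euclidean T (\<lambda>(v, t). act v t \<one>)"
proof -
  have "continuous_map euclidean (G_topology a) (\<lambda>(v, t). G_elem a v t)"
    using continuous_on_G_elem by (auto simp: continuous_map_in_subtopology)
  then have "continuous_map euclidean T ((\<lambda>g. \<phi> g \<one>) \<circ> (\<lambda>(v, t). G_elem a v t))"
    using quotient_imp_continuous_map[OF orbit_map] continuous_map_compose by blast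
  then show ?thesis by (simp add: o_def case_prod_beta')
qed

definition stab_translations :: "(real \<times> real \<times> real) set" where
  "stab_translations = {v. (v, 0) \<in> stab}"

lemma closed_stab_translations: "closed stab_translations"
proof -
  have "continuous_map euclidean (euclidean :: ((real \<times> real \<times> real) \<times> real) topology) (\<lambda>v. (v, 0))"
    by (simp add: continuous_on_Pair)
  then have "continuous_map euclidean T ((\<lambda>(v, t). act v t \<one>) \<circ> (\<lambda>v. (v, 0)))"
    using continuous_orbit by (rule continuous_map_compose)
  then have "continuous_map euclidean T (\<lambda>v. act v 0 \<one>)" by (simp add: o_def)
  moreover have "closedin T {\<one>}"
    by (simp add: Hausdorff closedin_Hausdorff_singleton one_closed topspace_eq)
  ultimately have "closedin euclidean {v \<in> topspace euclidean. act v 0 \<one> \<in> {\<one>}}"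
    by (rule closedin_continuous_map_preimage)
  then show ?thesis by (simp add: stab_translations_def stab_def)
qed

lemma stab_translations_diff:
  "v \<in> stab_translations \<Longrightarrow> w \<in> stab_translations \<Longrightarrow> v - w \<in> stab_translations"
  using stab_mult[of v 0 "- w" 0] stab_inverse[of w 0] by (simp add: stab_translations_def)

lemma stab_diff_translations:
  assumes "(v, t) \<in> stab" "(w, t) \<in> stab"
  shows "v - w \<in> stab_translations"
  using stab_mult[OF assms(1) stab_inverse[OF assms(2)]]
  by (simp add: stab_translations_def flow_uminus flow_flow)

text \<open>Conjugation by \<open>(v, t)\<close> acts on translations as \<open>flow a t\<close>.\<close>

lemma flow_stab_translations:
  assumes "(v, t) \<in> stab" "k \<in> stab_translations"
  shows "flow a t k \<in> stab_translations"
  using stab_diff_translations[of "v + flow a t k" t v] stab_mult[OF assms(1), of k 0] assms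
  by (simp add: stab_translations_def)

text \<open>Otherwise the subspace \<open>U\<close> of directions of lines inside the stabilizer is nonzero, and it is invariant
  under \<open>flow a t\<close> for some \<open>t \<noteq> 0\<close>. Applying \<open>flow a t - exp t\<close> to a vector of \<open>U\<close> once or
  twice produces a common eigenvector of the whole flow in \<open>U\<close>, or shows that the
  vector itself is one. The line spanned by a common eigenvector is normal in \<open>G\<close>, which contradicts
  \<open>stab_core_free\<close>.\<close>

lemma countable_stab_translations: "countable stab_translations"
proof (rule ccontr)
  assume unc: "uncountable stab_translations"
  define U where "U = {u. \<forall>r. r *\<^sub>R u \<in> stab_translations}"
  obtain v t where vt: "(v, t) \<in> stab" and "t \<noteq> 0" by (rule stab_not_translations)
  have scaleU: "r *\<^sub>R u \<in> U" if "u \<in> U" for r u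
    using that by (auto simp: U_def)
  have diffU: "u - w \<in> U" if "u \<in> U" "w \<in> U" for u w
    using that stab_translations_diff by (auto simp: U_def scaleR_diff_right)
  have flowU: "flow a t u \<in> U" if "u \<in> U" for u
    using that flow_stab_translations[OF vt] by (simp add: U_def flip: flow_scaleR)
  have eigen: "u = 0" if "u \<in> U" and ev: "\<And>s. \<exists>r. flow a s u = r *\<^sub>R u" for u
  proof (rule stab_core_free)
    fix s
    obtain r where "flow a s u = r *\<^sub>R u" using ev by blast
    then show "(flow a s u, 0) \<in> stab" using \<open>u \<in> U\<close> by (auto simp: U_def stab_translations_def)
  qed
  have N: "((exp (a * t) - exp t) * x, t * exp t * z, 0) \<in> U" if "(x, y, z) \<in> U" for x y z
    using diffU[OF flowU[OF that] scaleU[OF that, of "exp t"]] by (simp add: flow_def algebra_simps)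
  obtain u where "u \<noteq> 0" "\<And>r. r *\<^sub>R u \<in> stab_translations"
    using uncountable_closed_subgroup_contains_line
      [OF closed_stab_translations unc stab_translations_diff] by metis
  then have u: "u \<in> U" "u \<noteq> 0" by (simp_all add: U_def)
  obtain x y z where xyz: "u = (x, y, z)" by (cases u)
  let ?d = "exp (a * t) - exp t"
  have xyzU: "(x, y, z) \<in> U" using u xyz by simp
  have x0: "?d * x = 0"
  proof -
    have "(?d * (?d * x), 0, 0) \<in> U" using N[OF N[OF xyzU]] by simp
    then have "(?d * (?d * x), 0, 0) = (0 :: real \<times> real \<times> real)"
      by (rule eigen) (auto simp: flow_def intro!: exI[of _ "exp (a * _)"])
    then show ?thesis by (auto simp: zero_prod_def)
  qed
  have "(0, t * exp t * z, 0) \<in> U" using N[OF xyzU] x0 by simp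
  then have "(0, t * exp t * z, 0) = (0 :: real \<times> real \<times> real)"
    by (rule eigen) (auto simp: flow_def)
  then have z: "z = 0" using \<open>t \<noteq> 0\<close> by (simp add: zero_prod_def)
  have "u = 0"
  proof (rule eigen[OF \<open>u \<in> U\<close>])
    fix s
    \<comment> \<open>For \<open>a = 1\<close> the first two coordinates share their eigenvalue, and otherwise \<open>x = 0\<close>.\<close>
    have "flow a s u = exp s *\<^sub>R u" if "a = 1" using that by (simp add: xyz z flow_def)
    moreover have "flow a s u = exp s *\<^sub>R u" if "a \<noteq> 1"
    proof -
      have "?d \<noteq> 0" using that \<open>t \<noteq> 0\<close> by simp
      then show ?thesis using x0 by (simp add: xyz z flow_def)
    qed
    ultimately show "\<exists>r. flow a s u = r *\<^sub>R u" by blast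
  qed
  with u show False by simp
qed

text \<open>For each \<open>t\<close>, the elements \<open>(v, t)\<close> of \<open>H\<close> form a coset of the countable group \<open>K\<close>. The times
  \<open>t\<close> that occur are countable in number too: they are recovered from \<open>flow a t k \<in> K\<close>.\<close>

lemma countable_stab:
  assumes "k \<in> stab_translations" "k \<noteq> 0"
  shows "countable stab"
proof -
  let ?R = "snd ` stab"
  have "inj_on (\<lambda>t. flow a t k) ?R"
  proof (rule inj_onI)
    fix s t assume "flow a s k = flow a t k"
    then have "flow a (- t) (flow a s k) = flow a (- t) (flow a t k)" by simp
    then have "flow a (s - t) k = k" by (simp add: flow_flow)
    then show "s = t" using flow_fixes_imp_zero[OF a_nonzero _ \<open>k \<noteq> 0\<close>] by fastforce
  qed
  moreover have "(\<lambda>t. flow a t k) ` ?R \<subseteq> stab_translations"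
    using flow_stab_translations[OF _ assms(1)] by auto
  ultimately have R: "countable ?R"
    using countable_stab_translations by (meson countable_image_inj_on countable_subset)
  have "\<exists>f. \<forall>t\<in>?R. (f t, t) \<in> stab"
    by (rule bchoice) force
  then obtain f where f: "\<And>t. t \<in> ?R \<Longrightarrow> (f t, t) \<in> stab" by blast
  have "stab \<subseteq> (\<lambda>(t, k). (f t + k, t)) ` (?R \<times> stab_translations)"
  proof
    fix h assume h: "h \<in> stab"
    obtain v t where vt: "h = (v, t)" by (cases h)
    have t: "t \<in> ?R" using h vt by force
    have "v - f t \<in> stab_translations" using stab_diff_translations h f[OF t] vt by blast
    then show "h \<in> (\<lambda>(t, k). (f t + k, t)) ` (?R \<times> stab_translations)"
      using t vt by (intro image_eqI[of _ _ "(t, v - f t)"]) auto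
  qed
  then show ?thesis
    using R countable_stab_translations by (meson countable_SIGMA countable_image countable_subset)
qed

text \<open>The map \<open>inner u\<close> in the proof is trivial exactly if \<open>(u y) w = u (y w)\<close> for all \<open>w\<close>. It fixes
  the identity, so the curve \<open>\<tau> \<mapsto> inner (\<gamma> \<tau>) z\<close> stays in the countable orbit of \<open>z\<close> and must be
  constant; it starts at \<open>z\<close>.\<close>

lemma countable_stab_imp_group:
  assumes "countable stab"
  shows "group L"
proof (rule associative_imp_group)
  fix x y z assume x: "x \<in> carrier L" and y: "y \<in> carrier L" and z: "z \<in> carrier L"
  obtain v t where vt: "x = act v t \<one>" using act_transitive[OF x] .
  define \<gamma> where "\<gamma> \<tau> = act (\<tau> *\<^sub>R v) (\<tau> * t) \<one>" for \<tau>
  have \<gamma>_closed: "\<gamma> \<tau> \<in> carrier L" for \<tau> by (simp add: \<gamma>_def one_closed)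
  define inner where "inner u w = loop_ldiv L y (loop_ldiv L u ((u \<otimes> y) \<otimes> w))" for u w
  define F where "F \<tau> = inner (\<gamma> \<tau>) z" for \<tau>
  have "continuous_map euclideanreal (euclidean :: ((real \<times> real \<times> real) \<times> real) topology)
      (\<lambda>\<tau>. (\<tau> *\<^sub>R v, \<tau> * t))"
    by (auto intro!: continuous_intros)
  then have "continuous_map euclideanreal T ((\<lambda>(v, t). act v t \<one>) \<circ> (\<lambda>\<tau>. (\<tau> *\<^sub>R v, \<tau> * t)))"
    using continuous_orbit by (rule continuous_map_compose)
  then have \<gamma>: "continuous_map euclideanreal T \<gamma>" by (simp add: o_def \<gamma>_def[abs_def])
  have op: "continuous_map euclideanreal T (\<lambda>\<tau>. f (g \<tau>) (h \<tau>))"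
    if "continuous_map (prod_topology T T) T (\<lambda>(x, y). f x y)"
      "continuous_map euclideanreal T g" "continuous_map euclideanreal T h" for f g h
    using continuous_map_compose[OF continuous_map_pairedI[OF that(2,3)] that(1)] by (simp add: o_def)
  have const: "continuous_map euclideanreal T (\<lambda>\<tau>. c)" if "c \<in> carrier L" for c
    using that by (simp add: topspace_eq)
  have "continuous_map euclideanreal T F"
    unfolding F_def inner_def
    by (intro op[OF continuous_ldiv] op[OF continuous_mult] \<gamma> const y z)
  moreover have "range F \<subseteq> (\<lambda>(v, t). act v t z) ` stab"
  proof
    fix c assume "c \<in> range F"
    then obtain \<tau> where c: "c = F \<tau>" by blast
    have "in_Mult (inner (\<gamma> \<tau>))" unfolding inner_def
      by (intro in_Mult_comp[OF in_Mult_ldiv in_Mult_comp[OF in_Mult_ldiv in_Mult_left]]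
          mult_closed \<gamma>_closed y)
    moreover have "inner (\<gamma> \<tau>) \<one> = \<one>"
      using y \<gamma>_closed[of \<tau>] by (simp add: inner_def right_one mult_closed ldiv_mult ldiv_self)
    ultimately obtain v t where "(v, t) \<in> stab" "inner (\<gamma> \<tau>) z = act v t z"
      using inner_in_stab z by metis
    then show "c \<in> (\<lambda>(v, t). act v t z) ` stab" using c F_def by force
  qed
  then have "countable (range F)" using assms countable_image countable_subset by metis
  ultimately have "F 1 = F 0"
    using continuous_countable_range_constant Hausdorff_imp_t1_space[OF Hausdorff] by metis
  moreover have "F 0 = z"
    using y z ldiv_mult[OF one_closed, of "y \<otimes> z"]
    by (simp add: F_def inner_def \<gamma>_def one_closed left_one mult_closed ldiv_mult)
  ultimately have "inner x z = z" by (simp add: F_def \<gamma>_def vt)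
  then show "(x \<otimes> y) \<otimes> z = x \<otimes> (y \<otimes> z)"
    using ldiv[of x "(x \<otimes> y) \<otimes> z"] ldiv[of y "loop_ldiv L x ((x \<otimes> y) \<otimes> z)"] x y z mult_closed
    unfolding inner_def by metis
qed

text \<open>Here \<open>H\<close> is the full stabilizer of a point \<open>p\<close> in the affine action of \<open>G\<close> on \<open>V\<close>. The translations
  act simply transitively on the loop, and in the resulting coordinates \<open>E\<close> every left and right
  translation of the loop is affine with a linear part from the flow. Comparing the two descriptions of a product
  forces all these linear parts to be the identity.\<close>

lemma trivial_stab_translations_imp_group:
  assumes triv: "\<And>k. k \<in> stab_translations \<Longrightarrow> k = 0"
  shows "group L"
proof -
  obtain v0 t0 where h0: "(v0, t0) \<in> stab" "t0 \<noteq> 0" by (rule stab_not_translations)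
  obtain p where p: "v0 = p - flow a t0 p"
    using id_minus_flow_surj[OF a_nonzero h0(2)] .
  \<comment> \<open>Commutators of elements of \<open>H\<close> lie in \<open>K = 0\<close>; commuting with \<open>(v0, t0)\<close> forces \<open>p\<close> to be fixed.\<close>
  have stab_sub: "v = p - flow a t p" if "(v, t) \<in> stab" for v t
  proof -
    have "(v0 + flow a t0 v) - (v + flow a t v0) \<in> stab_translations"
      using stab_diff_translations stab_mult[OF h0(1) that] stab_mult[OF that h0(1)]
      by (simp add: add.commute)
    then have "(v0 + flow a t0 v) - (v + flow a t v0) = 0" by (rule triv)
    then have "flow a t0 (v - (p - flow a t p)) = v - (p - flow a t p)"
      by (simp add: p flow_diff flow_add flow_flow algebra_simps)
    then show ?thesis using flow_fixes_imp_zero[OF a_nonzero] h0(2) by fastforce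
  qed
  \<comment> \<open>The stabilizer of \<open>p\<close> is abelian and contains \<open>H\<close>, so it normalizes \<open>H\<close>.\<close>
  have stab_sup: "(p - flow a t p, t) \<in> stab" for t
  proof (rule stab_normalizer)
    fix w s assume ws: "(w, s) \<in> stab"
    show "\<exists>w' s'. (w', s') \<in> stab \<and>
      G_elem a w s ** G_elem a (p - flow a t p) t = G_elem a (p - flow a t p) t ** G_elem a w' s'"
      by (intro exI[of _ w] exI[of _ s])
        (use ws stab_sub[OF ws] in \<open>simp add: G_elem_mult G_elem_inject flow_diff flow_flow add.commute\<close>)
  qed
  define E where "E w = act w 0 \<one>" for w
  have E_closed: "E w \<in> carrier L" for w by (simp add: E_def one_closed)
  have act_one: "act v t \<one> = E (v - p + flow a t p)" for v t
  proof -
    have "act (v - p + flow a t p) 0 (act (p - flow a t p) t \<one>) = act v t \<one>"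
      by (simp add: act_act one_closed)
    then show ?thesis using stab_sup[of t] by (simp add: E_def stab_def)
  qed
  have E_inj: "v = w" if "E v = E w" for v w
  proof -
    have "act (- w) 0 (E v) = \<one>"
      using that by (simp add: E_def act_act one_closed)
    then have "v - w \<in> stab_translations"
      by (simp add: E_def act_act one_closed stab_translations_def stab_def)
    then show ?thesis using triv by fastforce
  qed
  have E_surj: "\<exists>v. x = E v" if "x \<in> carrier L" for x
    using act_transitive[OF that] act_one by metis
  have act_E: "act v t (E y) = E (v - p + flow a t (p + y))" for v t y
    using act_one[of "v + flow a t y" t]
    by (simp add: E_def act_act one_closed flow_add algebra_simps)
  have affine: "\<exists>t. \<forall>y. f (E y) = E (x + flow a t y)" if f: "in_Mult f" "f \<one> = E x" for f x
  proof -
    obtain v t where vt: "\<And>y. y \<in> carrier L \<Longrightarrow> f y = act v t y"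
      using f(1) unfolding in_Mult_def by blast
    have "E x = E (v - p + flow a t p)" using f(2) vt[OF one_closed] act_one by simp
    then have "x = v - p + flow a t p" by (rule E_inj)
    then have "f (E y) = E (x + flow a t y)" for y
      using vt[OF E_closed] act_E[of v t y] by (simp add: flow_add add.assoc)
    then show ?thesis by blast
  qed
  have "\<exists>t. \<forall>y. E x \<otimes> E y = E (x + flow a t y)" for x
    using affine[OF in_Mult_left[OF E_closed]] right_one E_closed by simp
  then obtain f where f: "\<And>x y. E x \<otimes> E y = E (x + flow a (f x) y)" by metis
  have "\<exists>t. \<forall>x. E x \<otimes> E y = E (y + flow a t x)" for y
    using affine[OF in_Mult_right[OF E_closed]] left_one E_closed by simp
  then obtain g where g: "\<And>x y. E x \<otimes> E y = E (y + flow a (g y) x)" by metis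
  have eq: "x + flow a (f x) y = y + flow a (g y) x" for x y
    by (rule E_inj) (metis f g)
  have "f x = 0" for x
  proof -
    define c where "c = exp (a * g (1, 0, 0)) - 1"
    have key: "exp (a * f x) - 1 = c * fst x" for x
      using arg_cong[OF eq[of x "(1, 0, 0)"], of fst]
      by (cases x) (simp add: flow_def c_def algebra_simps)
    have "c = 0"
    proof (rule ccontr)
      assume "c \<noteq> 0"
      \<comment> \<open>The point with first coordinate \<open>- 1 / c\<close> would make the exponential vanish.\<close>
      then have "exp (a * f (- 1 / c, 0, 0)) = 0" using key[of "(- 1 / c, 0, 0)"] by simp
      then show False by simp
    qed
    then show ?thesis using key[of x] a_nonzero by simp
  qed
  then have Emult: "E x \<otimes> E y = E (x + y)" for x y using f by simp
  show ?thesis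
  proof (rule associative_imp_group)
    fix x y z assume "x \<in> carrier L" "y \<in> carrier L" "z \<in> carrier L"
    then obtain u v w where "x = E u" "y = E v" "z = E w" using E_surj by metis
    then show "(x \<otimes> y) \<otimes> z = x \<otimes> (y \<otimes> z)" by (simp add: Emult add.assoc)
  qed
qed

lemma is_group: "group L"
proof (cases "\<exists>k\<in>stab_translations. k \<noteq> 0")
  case True
  then show ?thesis using countable_stab countable_stab_imp_group by blast
next
  case False
  then show ?thesis by (intro trivial_stab_translations_imp_group) blast
qed

end

theorem theorem4:
  fixes a :: real
  assumes "a \<noteq> 0"
  shows "\<not> (\<exists>(L :: 'a monoid) T.
            topological_loop L T \<and> connected_space T \<and> proper_loop L \<and>
            is_multiplication_group (G_group a) (G_topology a) L T)"
proof
  assume "\<exists>(L :: 'a monoid) T.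
            topological_loop L T \<and> connected_space T \<and> proper_loop L \<and>
            is_multiplication_group (G_group a) (G_topology a) L T"
  then obtain L :: "'a monoid" and T where L: "topological_loop L T" "proper_loop L"
    and mg: "is_multiplication_group (G_group a) (G_topology a) L T"
    by blast
  obtain \<phi> where "\<phi> \<in> iso (G_group a) (Mult L)"
      "quotient_map (G_topology a) T (\<lambda>g. \<phi> g \<one>\<^bsub>L\<^esub>)" "Hausdorff_space T"
    using mg unfolding is_multiplication_group_def by blast
  then have "loop_with_mult_group_G L T a \<phi>"
    using L(1) assms by (simp add: loop_with_mult_group_G_def loop_with_mult_group_G_axioms_def)
  then have "group L" by (rule loop_with_mult_group_G.is_group)
  with L(2) show False by (simp add: proper_loop_def)
qed

end
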